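(* Let $A = \{a_1 < a_2 < \dots\}$ be an admissible infinite strictly increasing sequence of natural numbers such that $a_j \ge \max\big(\exp(5j/\log j),\, a_{j-1} + a_{j-1}^{10/11}\big)$ for all sufficiently large $j$. Then for all sufficiently large $j$ there exists $n \in \mathbb{N}$ with $a_{j-1} < n < a_j$ such that $n + a_i$ is squarefree for all $i < j$.
   Context: A set $A \subseteq \mathbb{N}$ is admissible if for each prime $p$ there is a residue class $b_p \pmod{p^2}$ containing no element of $A$. *)

theory Defs
  imports Complex_Main "HOL-Number_Theory.Cong" "HOL-Computational_Algebra.Squarefree"
begin

definition admissible :: "nat set \<Rightarrow> bool" where
  "admissible A \<longleftrightarrow>
     (\<forall>p::nat. prime p \<longrightarrow> (\<exists>b::nat. \<forall>a\<in>A. \<not> [a = b] (mod p ^ 2)))"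

end

theory Submission
  imports Defs "HOL-Real_Asymp.Real_Asymp"
begin

text \<open>
  Let \<open>x = a (j - 1)\<close>, let \<open>s\<close> be the cube root of \<open>j\<close> and let \<open>Y\<close> be about \<open>s\<^sup>2\<close>. By admissibility and
  the Chinese remainder theorem there is a residue class modulo \<open>M = exp (O (s\<^sup>2 ln j))\<close> on which no
  \<open>n + a i\<close> is divisible by \<open>p\<^sup>2\<close> for a prime \<open>p \<le> Y\<close>. Inside this class, the primes between \<open>Y\<close> and
  \<open>Z\<close>, with \<open>Z\<close> about \<open>8 j exp (2 s)\<close>, are handled by Brun's pure sieve: each \<open>p\<^sup>2\<close> forbids at most \<open>j\<close>
  residue classes and the forbidden densities add up to at most \<open>j / Y \<le> s\<close>, because the sum of
  \<open>1 / n\<^sup>2\<close> over all \<open>n > Y\<close> is at most \<open>1 / Y\<close>; no information on the distribution of primes is used.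
  Truncated at level \<open>R = O (s)\<close>, the sieve leaves a proportion of at least \<open>exp (- 2 s) / 2\<close> up to an
  error \<open>3 (j Z) ^ R = exp (O (s\<^sup>2))\<close>. The primes beyond \<open>Z\<close> are removed by the union bound, at a cost
  of at most \<open>j\<close> times \<open>O (sqrt x)\<close>, plus an eighth of the main term. All losses other than \<open>sqrt x\<close>
  are \<open>exp (o (j / ln j))\<close>, so they are small powers of \<open>x\<close>, and \<open>10/11 > 1/2\<close> leaves ample room.
\<close>

section \<open>Truncated inclusion-exclusion\<close>

text \<open>For nonempty \<open>b\<close>, grouping by cardinality gives a truncated alternating sum
  of binomial coefficients, which collapses to \<open>(-1) ^ R\<close> times
  \<open>card b - 1\<close> choose \<open>R\<close>. Odd \<open>R\<close> makes this nonpositive, so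
  the sum is a lower bound for the indicator of \<open>b = {}\<close>.\<close>

lemma bonferroni_odd:
  assumes "finite b" "odd R"
  shows "(\<Sum>D | D \<subseteq> b \<and> card D \<le> R. (-1::real) ^ card D) \<le> (if b = {} then 1 else 0)"
proof (cases "b = {}")
  case True
  then have "{D. D \<subseteq> b \<and> card D \<le> R} = {{}}" by auto
  then show ?thesis using True by simp
next
  case False
  let ?S = "{D. D \<subseteq> b \<and> card D \<le> R}"
  have fin: "finite ?S" using assms(1) by simp
  have "(\<Sum>D\<in>?S. (-1::real) ^ card D) = (\<Sum>r\<le>R. \<Sum>D | D \<in> ?S \<and> card D = r. (-1) ^ card D)"
    by (rule sum.group[symmetric]) (use fin in auto)
  also have "\<dots> = (\<Sum>r\<le>R. (real (card b) gchoose r) * (-1) ^ r)"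
  proof (rule sum.cong[OF refl])
    fix r assume "r \<in> {..R}"
    then have "{D. D \<in> ?S \<and> card D = r} = {D. D \<subseteq> b \<and> card D = r}" by auto
    then show "(\<Sum>D | D \<in> ?S \<and> card D = r. (-1) ^ card D) = (real (card b) gchoose r) * (-1) ^ r"
      using n_subsets[OF assms(1), of r] by (simp add: binomial_gbinomial)
  qed
  also have "\<dots> = (-1) ^ R * (real (card b) - 1 gchoose R)"
    by (rule gbinomial_sum_lower_neg)
  also have "real (card b) - 1 = real (card b - 1)"
    using False assms(1) by (simp add: of_nat_diff card_gt_0_iff Suc_leI)
  also have "(-1) ^ R * (real (card b - 1) gchoose R) \<le> 0"
    using assms(2) by (simp flip: binomial_gbinomial)
  finally show ?thesis using False by simp
qed

section \<open>Residue classes in intervals and the Chinese remainder theorem\<close>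

text \<open>A block of \<open>Q\<close> consecutive integers meets the class exactly once, so
  removing it lowers both the count and \<open>X / Q\<close> by 1. What remains is an interval
  shorter than \<open>Q\<close>, where both quantities lie between 0 and 1.\<close>

lemma card_interval_cong:
  fixes u X Q c :: nat
  assumes "c < Q"
  shows "\<bar>real (card {n \<in> {u..<u + X}. n mod Q = c}) - real X / real Q\<bar> \<le> 1"
proof (induction X arbitrary: u rule: less_induct)
  case (less X)
  have Q: "Q > 0" using assms by simp
  have inj: "inj_on (\<lambda>n. n mod Q) {u..<u + Q}" for u
  proof (rule inj_onI)
    have *: "x = y" if "x \<le> y" "x \<in> {u..<u + Q}" "y \<in> {u..<u + Q}" "x mod Q = y mod Q" for x y
    proof -
      have "Q dvd y - x" using that by (metis mod_eq_dvd_iff_nat)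
      moreover have "y - x < Q" using that by auto
      ultimately show ?thesis using that(1) by (metis diff_is_0_eq dvd_imp_le le_antisym linorder_not_less neq0_conv)
    qed
    fix x y assume "x \<in> {u..<u + Q}" "y \<in> {u..<u + Q}" "x mod Q = y mod Q"
    then show "x = y" using *[of x y] *[of y x] by (cases "x \<le> y") auto
  qed
  show ?case
  proof (cases "X < Q")
    case True
    have "inj_on (\<lambda>n. n mod Q) {n \<in> {u..<u + X}. n mod Q = c}"
      by (rule inj_on_subset[OF inj[of u]]) (use True in auto)
    then have "card {n \<in> {u..<u + X}. n mod Q = c} \<le> card {c}"
      by (rule card_inj_on_le) auto
    moreover have "real X / real Q \<le> 1" using True by (simp add: field_simps)
    moreover have "real X / real Q \<ge> 0" by simp
    moreover have "real (card {n \<in> {u..<u + X}. n mod Q = c}) \<in> {0..1}"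
      using calculation(1) by simp
    ultimately show ?thesis unfolding atLeastAtMost_iff abs_le_iff by linarith
  next
    case False
    have "(\<lambda>n. n mod Q) ` {u..<u + Q} = {..<Q}"
      by (rule card_subset_eq) (use Q inj in \<open>auto simp: card_image\<close>)
    then obtain m where m: "m \<in> {u..<u + Q}" "m mod Q = c"
      using assms by (metis imageE lessThan_iff)
    have "{n \<in> {u..<u + Q}. n mod Q = c} = {m}"
      using m inj[of u] by (auto simp: inj_on_def)
    then have one: "card {n \<in> {u..<u + Q}. n mod Q = c} = 1" by simp
    have split: "{n \<in> {u..<u + X}. n mod Q = c} =
        {n \<in> {u..<u + Q}. n mod Q = c} \<union> {n \<in> {u + Q..<(u + Q) + (X - Q)}. n mod Q = c}"
      using False by auto
    have "card {n \<in> {u..<u + X}. n mod Q = c} =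
        1 + card {n \<in> {u + Q..<(u + Q) + (X - Q)}. n mod Q = c}"
      unfolding one[symmetric] split by (rule card_Un_disjoint) auto
    moreover have "real X / real Q = 1 + real (X - Q) / real Q"
      using Q False by (simp add: field_simps of_nat_diff)
    ultimately show ?thesis using less.IH[of "X - Q" "u + Q"] Q False by simp
  qed
qed

lemma card_interval_residues:
  fixes u X Q :: nat
  assumes "C \<subseteq> {..<Q}"
  shows "\<bar>real (card {n \<in> {u..<u + X}. n mod Q \<in> C}) - real X * real (card C) / real Q\<bar> \<le> real (card C)"
proof -
  have fin: "finite C" using assms finite_subset by blast
  have "{n \<in> {u..<u + X}. n mod Q \<in> C} = (\<Union>c\<in>C. {n \<in> {u..<u + X}. n mod Q = c})" by auto
  then have "card {n \<in> {u..<u + X}. n mod Q \<in> C} = (\<Sum>c\<in>C. card {n \<in> {u..<u + X}. n mod Q = c})"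
    using fin by (simp, subst card_UN_disjoint) auto
  then have "real (card {n \<in> {u..<u + X}. n mod Q \<in> C}) - real X * real (card C) / real Q
      = (\<Sum>c\<in>C. real (card {n \<in> {u..<u + X}. n mod Q = c}) - real X / real Q)"
    by (simp add: sum_subtractf)
  also have "\<bar>\<dots>\<bar> \<le> (\<Sum>c\<in>C. \<bar>real (card {n \<in> {u..<u + X}. n mod Q = c}) - real X / real Q\<bar>)"
    by (rule sum_abs)
  also have "\<dots> \<le> (\<Sum>c\<in>C. 1)"
    by (rule sum_mono, rule card_interval_cong) (use assms in auto)
  finally show ?thesis by simp
qed

text \<open>Merges conditions to coprime moduli into one condition modulo the product, so that the
  interval count applies to all of them at once. The induction step is the bijection between
  residues modulo \<open>q r * Q\<close> and pairs of residues.\<close>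

lemma crt_residue_sets:
  fixes q :: "'a \<Rightarrow> nat"
  assumes "finite D" "\<And>p. p \<in> D \<Longrightarrow> q p > 0" "\<And>p. p \<in> D \<Longrightarrow> B p \<subseteq> {..<q p}"
    and "\<And>p r. p \<in> D \<Longrightarrow> r \<in> D \<Longrightarrow> p \<noteq> r \<Longrightarrow> coprime (q p) (q r)"
  shows "\<exists>C \<subseteq> {..<prod q D}. card C = (\<Prod>p\<in>D. card (B p)) \<and>
    (\<forall>n. n mod prod q D \<in> C \<longleftrightarrow> (\<forall>p\<in>D. n mod q p \<in> B p))"
  using assms
proof (induction D rule: finite_induct)
  case empty
  show ?case by (rule exI[of _ "{0}"]) auto
next
  case (insert r D)
  have "\<exists>C \<subseteq> {..<prod q D}. card C = (\<Prod>p\<in>D. card (B p)) \<and>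
    (\<forall>n. n mod prod q D \<in> C \<longleftrightarrow> (\<forall>p\<in>D. n mod q p \<in> B p))"
    by (rule insert.IH) (use insert.prems in auto)
  then obtain C where C: "C \<subseteq> {..<prod q D}" "card C = (\<Prod>p\<in>D. card (B p))"
    "\<And>n. n mod prod q D \<in> C \<longleftrightarrow> (\<forall>p\<in>D. n mod q p \<in> B p)" by blast
  define Q where "Q = prod q D"
  have Q: "Q > 0" unfolding Q_def using insert.prems(1) by (auto intro!: prod_pos)
  have r: "q r > 0" "B r \<subseteq> {..<q r}" using insert.prems by auto
  have cop: "coprime (q r) Q" unfolding Q_def
    using insert.prems(3) insert.hyps(2) by (intro prod_coprime_right) auto
  define C' where "C' = {c \<in> {..<q r * Q}. c mod q r \<in> B r \<and> c mod Q \<in> C}"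
  have "bij_betw (\<lambda>c. (c mod q r, c mod Q)) C' (B r \<times> C)"
    unfolding bij_betw_def
  proof
    show "inj_on (\<lambda>c. (c mod q r, c mod Q)) C'"
    proof (rule inj_onI)
      fix x y assume xy: "x \<in> C'" "y \<in> C'" "(x mod q r, x mod Q) = (y mod q r, y mod Q)"
      then have "[x = y] (mod q r * Q)"
        by (intro coprime_cong_mult_nat cop) (simp_all add: Cong.cong_def)
      then show "x = y" using xy(1,2) by (simp add: C'_def Cong.cong_def)
    qed
    show "(\<lambda>c. (c mod q r, c mod Q)) ` C' = B r \<times> C"
    proof (intro equalityI subsetI)
      fix z assume "z \<in> B r \<times> C"
      then obtain s t where z: "z = (s, t)" "s \<in> B r" "t \<in> C" by auto
      obtain x where x: "x < q r * Q" "[x = s] (mod q r)" "[x = t] (mod Q)"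
        using binary_chinese_remainder_unique_nat[OF cop, of s t] r Q by auto
      have "x mod q r = s" "x mod Q = t"
        using x z r C(1) by (auto simp: Cong.cong_def Q_def)
      then show "z \<in> (\<lambda>c. (c mod q r, c mod Q)) ` C'"
        using x z by (auto simp: C'_def image_iff intro!: bexI[of _ x])
    qed (auto simp: C'_def)
  qed
  then have "card C' = card (B r) * card C"
    by (simp add: bij_betw_same_card card_cartesian_product)
  moreover have "n mod (q r * Q) \<in> C' \<longleftrightarrow> (\<forall>p\<in>insert r D. n mod q p \<in> B p)" for n
    using C(3)[of n] r Q by (simp add: C'_def mod_mod_cancel Q_def[symmetric])
  ultimately show ?case
    using insert.hyps C(2) by (intro exI[of _ C']) (auto simp: C'_def Q_def)
qed

section \<open>Brun's pure sieve\<close>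

lemma sum_Pow_prod:
  fixes f :: "'a \<Rightarrow> real"
  assumes "finite A"
  shows "(\<Sum>D\<in>Pow A. \<Prod>p\<in>D. f p) = (\<Prod>p\<in>A. f p + 1)"
  using prod_add[OF assms, of f "\<lambda>_. 1"] by simp

lemma exp_le_one_minus:
  fixes x :: real
  assumes "0 \<le> x" "x \<le> 1 / 2"
  shows "exp (- 2 * x) \<le> 1 - x"
proof -
  have "x * x \<le> x * (1 / 2)" using assms by (intro mult_left_mono) auto
  then have "- 2 * x \<le> - x - 2 * x\<^sup>2" by (simp add: power2_eq_square)
  also have "\<dots> \<le> ln (1 - x)" using assms by (rule ln_one_minus_pos_lower_bound)
  finally have "exp (- 2 * x) \<le> exp (ln (1 - x))" by simp
  then show ?thesis using assms by simp
qed

text \<open>Bonferroni is summed over the interval and each count is replaced by its density. The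
  densities sum to an Euler product up to a tail that \<open>R\<close> makes small; the rounding
  errors cost at most \<open>3 * (k * z) ^ R\<close>. The bound 1/2 on each density gives
  \<open>1 - g p\<close> \<ge> \<open>exp (- 2 * g p)\<close>.\<close>

lemma brun_sieve:
  fixes q :: "'a \<Rightarrow> nat" and S :: real and k z R u X :: nat
  assumes fin: "finite P" and pos: "\<And>p. p \<in> P \<Longrightarrow> q p > 0"
    and sub: "\<And>p. p \<in> P \<Longrightarrow> B p \<subseteq> {..<q p}"
    and cop: "\<And>p r. p \<in> P \<Longrightarrow> r \<in> P \<Longrightarrow> p \<noteq> r \<Longrightarrow> coprime (q p) (q r)"
    and k: "\<And>p. p \<in> P \<Longrightarrow> card (B p) \<le> k"
    and half: "\<And>p. p \<in> P \<Longrightarrow> 2 * card (B p) \<le> q p"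
    and S: "(\<Sum>p\<in>P. real (card (B p)) / real (q p)) \<le> S"
    and z: "card P \<le> z" "k > 0" "z > 0"
    and R: "odd R" "2 * exp (4 * S) \<le> 2 ^ R"
  shows "real X * exp (- 2 * S) / 2 - 3 * real (k * z) ^ R
      \<le> real (card {n \<in> {u..<u + X}. \<forall>p\<in>P. n mod q p \<notin> B p})"
proof -
  define I where "I = {u..<u + X}"
  define b where "b = (\<lambda>n. {p \<in> P. n mod q p \<in> B p})"
  define F where "F = {D. D \<subseteq> P \<and> card D \<le> R}"
  define g where "g = (\<lambda>p. real (card (B p)) / real (q p))"
  define N where "N = (\<lambda>D. real (card {n \<in> I. D \<subseteq> b n}))"
  have finI: "finite I" by (simp add: I_def)
  have finF: "finite F" using fin by (simp add: F_def)
  have g: "0 \<le> g p" "g p \<le> 1 / 2" if "p \<in> P" for p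
    using pos[OF that] half[OF that] by (simp_all add: g_def field_simps flip: of_nat_mult)
  have N: "\<bar>N D - real X * (\<Prod>p\<in>D. g p)\<bar> \<le> (\<Prod>p\<in>D. real (card (B p)))" if "D \<in> F" for D
  proof -
    have D: "D \<subseteq> P" "finite D" using that fin finite_subset by (auto simp: F_def)
    have "\<exists>C \<subseteq> {..<prod q D}. card C = (\<Prod>p\<in>D. card (B p)) \<and>
        (\<forall>n. n mod prod q D \<in> C \<longleftrightarrow> (\<forall>p\<in>D. n mod q p \<in> B p))"
      by (rule crt_residue_sets) (use D pos sub in auto, use D(1) cop in blast)
    then obtain C where C: "C \<subseteq> {..<prod q D}" "card C = (\<Prod>p\<in>D. card (B p))"
      "\<And>n. n mod prod q D \<in> C \<longleftrightarrow> (\<forall>p\<in>D. n mod q p \<in> B p)" by blast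
    have "{n \<in> I. D \<subseteq> b n} = {n \<in> {u..<u + X}. n mod prod q D \<in> C}"
      using D by (auto simp: C(3) I_def b_def)
    then show ?thesis
      using card_interval_residues[OF C(1), of u X] C(2)
      by (simp add: N_def g_def prod_dividef)
  qed
  have "real (card {n \<in> I. \<forall>p\<in>P. n mod q p \<notin> B p}) = (\<Sum>n\<in>I. if b n = {} then 1 else 0)"
  proof -
    have "{n \<in> I. \<forall>p\<in>P. n mod q p \<notin> B p} = I \<inter> {n. b n = {}}" by (auto simp: b_def)
    then show ?thesis using finI by (simp add: sum.If_cases)
  qed
  also have "\<dots> \<ge> (\<Sum>n\<in>I. \<Sum>D | D \<subseteq> b n \<and> card D \<le> R. (-1) ^ card D)"
    by (intro sum_mono bonferroni_odd R(1)) (use fin in \<open>simp add: b_def\<close>)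
  \<comment> \<open>As \<open>b n\<close> lies in \<open>P\<close>, the inner sum can run over the
    family \<open>F\<close>, which does not depend on \<open>n\<close>; this permits exchanging the
    two sums.\<close>
  also have "(\<Sum>n\<in>I. \<Sum>D | D \<subseteq> b n \<and> card D \<le> R. (-1::real) ^ card D)
      = (\<Sum>n\<in>I. \<Sum>D\<in>F. if D \<subseteq> b n then (-1) ^ card D else 0)"
  proof (rule sum.cong[OF refl])
    fix n assume "n \<in> I"
    have "{D. D \<subseteq> b n \<and> card D \<le> R} = {D \<in> F. D \<subseteq> b n}" by (auto simp: F_def b_def)
    then show "(\<Sum>D | D \<subseteq> b n \<and> card D \<le> R. (-1::real) ^ card D)
        = (\<Sum>D\<in>F. if D \<subseteq> b n then (-1) ^ card D else 0)"
      using finF by (simp add: sum.inter_filter)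
  qed
  also have "\<dots> = (\<Sum>D\<in>F. (-1) ^ card D * N D)"
    by (subst sum.swap) (simp add: N_def finI mult.commute flip: sum.inter_filter)
  finally have lower: "(\<Sum>D\<in>F. (-1) ^ card D * N D)
      \<le> real (card {n \<in> I. \<forall>p\<in>P. n mod q p \<notin> B p})" .
  have "real X * (\<Sum>D\<in>F. \<Prod>p\<in>D. - g p) - (\<Sum>D\<in>F. \<Prod>p\<in>D. real (card (B p)))
      = (\<Sum>D\<in>F. (-1) ^ card D * (real X * (\<Prod>p\<in>D. g p)) - (\<Prod>p\<in>D. real (card (B p))))"
    by (simp add: sum_subtractf sum_distrib_left prod_uminus mult_ac)
  also have "\<dots> \<le> (\<Sum>D\<in>F. (-1) ^ card D * N D)"
  proof (rule sum_mono)
    fix D assume "D \<in> F"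
    then show "(-1) ^ card D * (real X * (\<Prod>p\<in>D. g p)) - (\<Prod>p\<in>D. real (card (B p)))
        \<le> (-1) ^ card D * N D"
      using N[of D] by (cases "even (card D)") (auto simp: abs_le_iff)
  qed
  also note lower
  finally have *: "real X * (\<Sum>D\<in>F. \<Prod>p\<in>D. - g p) - (\<Sum>D\<in>F. \<Prod>p\<in>D. real (card (B p)))
      \<le> real (card {n \<in> I. \<forall>p\<in>P. n mod q p \<notin> B p})" .
  \<comment> \<open>The full product is at least \<open>exp (- 2 * S)\<close>. The sets with more
    than \<open>R\<close> elements contribute at most \<open>exp (2 * S) / 2 ^ R\<close>, and the
    lower bound on \<open>2 ^ R\<close> makes this at most half of
    \<open>exp (- 2 * S)\<close>.\<close>
  have "(\<Sum>D\<in>F. \<Prod>p\<in>D. - g p) \<ge> exp (- 2 * S) / 2"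
  proof -
    have "exp (- 2 * S) \<le> exp (\<Sum>p\<in>P. - 2 * g p)"
      using S unfolding sum_distrib_left[symmetric] g_def by simp
    also have "\<dots> = (\<Prod>p\<in>P. exp (- 2 * g p))" using fin by (rule exp_sum)
    also have "\<dots> \<le> (\<Prod>p\<in>P. - g p + 1)"
      by (rule prod_mono) (use g exp_le_one_minus in fastforce)
    also have "\<dots> = (\<Sum>D\<in>Pow P. \<Prod>p\<in>D. - g p)" by (simp only: sum_Pow_prod fin)
    also have "\<dots> = (\<Sum>D\<in>F. \<Prod>p\<in>D. - g p) + (\<Sum>D\<in>Pow P - F. \<Prod>p\<in>D. - g p)"
      using fin by (subst add.commute, intro sum.subset_diff) (auto simp: F_def)
    \<comment> \<open>Rankin's trick: a set with more than \<open>R\<close> elements may be weighted by 2 to the power \<open>card D - R\<close>.\<close>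
    also have "(\<Sum>D\<in>Pow P - F. \<Prod>p\<in>D. - g p) \<le> (\<Sum>D\<in>Pow P - F. (\<Prod>p\<in>D. 2 * g p) / 2 ^ R)"
    proof (rule sum_mono)
      fix D assume D: "D \<in> Pow P - F"
      then have "0 \<le> (\<Prod>p\<in>D. g p)" using g by (intro prod_nonneg) auto
      moreover have "(\<Prod>p\<in>D. - g p) \<le> (\<Prod>p\<in>D. g p)"
        using calculation by (cases "even (card D)") (auto simp: prod_uminus)
      moreover have "(2::real) ^ R \<le> 2 ^ card D"
        using D by (intro power_increasing) (auto simp: F_def)
      ultimately have "(\<Prod>p\<in>D. - g p) * 2 ^ R \<le> (\<Prod>p\<in>D. g p) * 2 ^ card D"
        by (intro mult_mono) auto
      then show "(\<Prod>p\<in>D. - g p) \<le> (\<Prod>p\<in>D. 2 * g p) / 2 ^ R"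
        by (simp add: prod.distrib pos_le_divide_eq mult_ac)
    qed
    also have "\<dots> \<le> (\<Sum>D\<in>Pow P. (\<Prod>p\<in>D. 2 * g p) / 2 ^ R)"
      by (rule sum_mono2) (use fin g in \<open>auto intro!: divide_nonneg_pos prod_nonneg\<close>)
    also have "\<dots> = (\<Prod>p\<in>P. 2 * g p + 1) / 2 ^ R"
      by (simp only: sum_Pow_prod fin flip: sum_divide_distrib)
    also have "\<dots> \<le> (\<Prod>p\<in>P. exp (2 * g p)) / 2 ^ R"
      by (intro divide_right_mono prod_mono)
        (use g exp_ge_add_one_self in \<open>auto simp: add.commute intro: add_nonneg_nonneg\<close>)
    also have "(\<Prod>p\<in>P. exp (2 * g p)) = exp (\<Sum>p\<in>P. 2 * g p)" using fin by (rule exp_sum[symmetric])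
    also have "\<dots> / 2 ^ R \<le> exp (2 * S) / (2 * exp (4 * S))"
      using S R(2) unfolding sum_distrib_left[symmetric] g_def by (intro frac_le) auto
    also have "exp (2 * S) / (2 * exp (4 * S)) = exp (- 2 * S) / 2"
      by (simp add: field_simps flip: exp_add)
    finally show ?thesis by simp
  qed
  moreover have "(\<Sum>D\<in>F. \<Prod>p\<in>D. real (card (B p))) \<le> 3 * real (k * z) ^ R"
  proof -
    \<comment> \<open>Giving each element of \<open>D\<close> the weight \<open>1 / z\<close> avoids
      counting \<open>F\<close>: the weights sum over all subsets of \<open>P\<close> to at most
      \<open>(1 + 1 / z) ^ z\<close>, hence to at most 3.\<close>
    have "(\<Sum>D\<in>F. \<Prod>p\<in>D. real (card (B p))) \<le> (\<Sum>D\<in>F. real (k * z) ^ R * (\<Prod>p\<in>D. 1 / real z))"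
    proof (rule sum_mono)
      fix D assume D: "D \<in> F"
      have "(\<Prod>p\<in>D. real (card (B p))) \<le> (\<Prod>p\<in>D. real k)"
        by (rule prod_mono) (use D k in \<open>auto simp: F_def\<close>)
      also have "\<dots> = real (k * z) ^ card D * (\<Prod>p\<in>D. 1 / real z)"
        using z by (simp add: power_divide power_mult_distrib)
      also have "\<dots> \<le> real (k * z) ^ R * (\<Prod>p\<in>D. 1 / real z)"
        by (intro mult_right_mono power_increasing prod_nonneg)
          (use D z in \<open>auto simp: F_def simp flip: of_nat_mult intro: Suc_leI\<close>)
      finally show "(\<Prod>p\<in>D. real (card (B p))) \<le> real (k * z) ^ R * (\<Prod>p\<in>D. 1 / real z)" .
    qed
    also have "\<dots> \<le> (\<Sum>D\<in>Pow P. real (k * z) ^ R * (\<Prod>p\<in>D. 1 / real z))"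
      by (rule sum_mono2) (use fin in \<open>auto simp: F_def\<close>)
    also have "\<dots> = real (k * z) ^ R * (\<Prod>p\<in>P. 1 / real z + 1)"
      by (simp only: sum_Pow_prod fin flip: sum_distrib_left)
    also have "\<dots> \<le> real (k * z) ^ R * 3"
    proof (rule mult_left_mono)
      have "(\<Prod>p\<in>P. 1 / real z + 1) \<le> (\<Prod>p\<in>P. exp (1 / real z))"
        by (rule prod_mono)
          (use exp_ge_add_one_self in \<open>auto simp: add.commute intro: add_nonneg_nonneg\<close>)
      also have "(\<Prod>p\<in>P. exp (1 / real z)) = exp (\<Sum>p\<in>P. 1 / real z)"
        using fin by (rule exp_sum[symmetric])
      also have "\<dots> \<le> exp 1" using z by simp
      also have "exp 1 \<le> (3::real)" by (rule exp_le)
      finally show "(\<Prod>p\<in>P. 1 / real z + 1) \<le> 3" .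
    qed simp
    finally show ?thesis by (simp add: mult.commute)
  qed
  ultimately have "real X * (exp (- 2 * S) / 2) - 3 * real (k * z) ^ R
      \<le> real X * (\<Sum>D\<in>F. \<Prod>p\<in>D. - g p) - (\<Sum>D\<in>F. \<Prod>p\<in>D. real (card (B p)))"
    by (intro diff_mono mult_left_mono) auto
  with * show ?thesis by (simp add: I_def)
qed

section \<open>Squares of primes and the classes they forbid\<close>

text \<open>Each term is at most \<open>1 / (n - 1) - 1 / n\<close>, and these differences
  telescope.\<close>

lemma sum_inverse_squares_le:
  fixes Y Z :: nat
  assumes "Y > 0"
  shows "(\<Sum>n\<in>{Y<..Z}. 1 / (real n)\<^sup>2) \<le> 1 / real Y"
proof (cases "Y \<le> Z")
  case True
  then have "(\<Sum>n\<in>{Y<..Z}. 1 / (real n)\<^sup>2) \<le> 1 / real Y - 1 / real Z"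
  proof (induction Z rule: dec_induct)
    case (step n)
    have "{Y<..Suc n} = insert (Suc n) {Y<..n}" using step.hyps by auto
    moreover have "1 / (real (Suc n))\<^sup>2 \<le> 1 / real n - 1 / real (Suc n)"
    proof -
      have n: "real n > 0" using step.hyps assms by simp
      have "1 / (real (Suc n))\<^sup>2 \<le> 1 / (real n * real (Suc n))"
        using n by (intro divide_left_mono) (auto simp: power2_eq_square)
      also have "\<dots> = 1 / real n - 1 / real (Suc n)" using n by (simp add: field_simps)
      finally show ?thesis .
    qed
    ultimately show ?case using step.IH by simp
  qed simp
  then show ?thesis by (smt (verit) divide_nonneg_nonneg of_nat_0_le_iff)
qed (use assms in simp)

lemma prod_prime_squares_le:
  assumes "Y > 0"
  shows "(\<Prod>p | prime p \<and> p \<le> Y. p\<^sup>2) \<le> Y ^ (2 * Y)"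
proof -
  have sub: "{p. prime p \<and> p \<le> Y} \<subseteq> {1..Y}" using prime_ge_1_nat by auto
  have "(\<Prod>p | prime p \<and> p \<le> Y. p\<^sup>2) \<le> (\<Prod>p | prime p \<and> p \<le> Y. Y\<^sup>2)"
    by (rule prod_mono) (auto intro: power_mono)
  also have "\<dots> = (Y\<^sup>2) ^ card {p. prime p \<and> p \<le> Y}" by simp
  also have "\<dots> \<le> (Y\<^sup>2) ^ Y"
    using card_mono[OF _ sub] assms by (intro power_increasing) auto
  finally show ?thesis by (simp add: power_mult)
qed

text \<open>Since \<open>M\<close> is invertible modulo \<open>q\<close>, each \<open>a\<close>
  excludes at most one residue of \<open>m\<close>.\<close>

lemma card_dvd_linear_le:
  fixes A :: "nat set"
  assumes "finite A" "coprime M q" "q > 0"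
  shows "card {m \<in> {..<q}. \<exists>a\<in>A. q dvd r + M * m + a} \<le> card A"
proof -
  have "card {m \<in> {..<q}. q dvd r + M * m + a} \<le> 1" for a
  proof (rule card_le_Suc0_iff_eq[THEN iffD2, simplified One_nat_def[symmetric]])
    show "\<forall>x\<in>{m \<in> {..<q}. q dvd r + M * m + a}. \<forall>y\<in>{m \<in> {..<q}. q dvd r + M * m + a}. x = y"
    proof (intro ballI)
      fix x y assume xy: "x \<in> {m \<in> {..<q}. q dvd r + M * m + a}" "y \<in> {m \<in> {..<q}. q dvd r + M * m + a}"
      then have "[(r + a) + M * x = (r + a) + M * y] (mod q)"
        by (auto simp: Cong.cong_def mod_eq_0_iff_dvd add_ac)
      then have "[M * x = M * y] (mod q)" by (simp only: cong_add_lcancel_nat)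
      then have "[x = y] (mod q)" using assms(2) by (simp add: cong_mult_lcancel_nat)
      then show "x = y" using xy by (simp add: Cong.cong_def)
    qed
  qed simp
  then have "(\<Sum>a\<in>A. card {m \<in> {..<q}. q dvd r + M * m + a}) \<le> (\<Sum>a\<in>A. 1)"
    by (intro sum_mono) auto
  moreover have "{m \<in> {..<q}. \<exists>a\<in>A. q dvd r + M * m + a} = (\<Union>a\<in>A. {m \<in> {..<q}. q dvd r + M * m + a})"
    by auto
  ultimately show ?thesis
    using card_UN_le[OF assms(1), of "\<lambda>a. {m \<in> {..<q}. q dvd r + M * m + a}"] by simp
qed

section \<open>The sieve applied to squarefree shifts\<close>

text \<open>Candidates are \<open>n = r + M * m\<close> with \<open>m\<close> in an interval of
  length \<open>X\<close>. The bound on \<open>H\<close> keeps them inside the gap, the bound on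
  \<open>T\<close> means that no prime above \<open>T\<close> has its square dividing
  \<open>n + a\<close>, and \<open>main\<close> says that the sieve leaves more \<open>m\<close>
  than the primes between \<open>Z\<close> and \<open>T\<close> can destroy.\<close>

lemma exists_squarefree_shift:
  fixes A :: "nat set" and k Y Z R T X H x :: nat and S :: real
  assumes A: "finite A" "card A \<le> k" "k > 0" "A \<subseteq> {..x}" "admissible A"
    and Y: "Y > 0" "2 * k \<le> Y\<^sup>2" "real k / real Y \<le> S" "Y \<le> Z"
    and R: "odd R" "2 * exp (4 * S) \<le> 2 ^ R"
    and H: "(\<Prod>p | prime p \<and> p \<le> Y. p\<^sup>2) * (X + 1) \<le> H"
    and T: "2 * x + H \<le> T\<^sup>2"
    and main: "real k * real X / real Z + real k * real T
        < real X * exp (- 2 * S) / 2 - 3 * real (k * Z) ^ R"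
  shows "\<exists>n. x < n \<and> n < x + H \<and> (\<forall>a\<in>A. squarefree (n + a))"
proof -
  define W where "W = {p::nat. prime p \<and> p \<le> Y}"
  define M where "M = (\<Prod>p\<in>W. p\<^sup>2)"
  have finW: "finite W" by (simp add: W_def)
  have cop: "coprime (p\<^sup>2) (r\<^sup>2)" if "prime p" "prime r" "p \<noteq> r" for p r :: nat
    using primes_coprime[OF that] by simp
  have "\<exists>b. \<forall>p. prime p \<longrightarrow> (\<forall>a\<in>A. \<not> [a = b p] (mod p\<^sup>2))"
    using A(5) unfolding admissible_def by metis
  then obtain b where b: "\<And>p a. prime p \<Longrightarrow> a \<in> A \<Longrightarrow> \<not> [a = b p] (mod p\<^sup>2)" by blast
  \<comment> \<open>The target residue is \<open>- b p\<close>, written as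
    \<open>p\<^sup>2 * b p - b p\<close> to stay in the natural numbers. Then \<open>n + a\<close>
    is congruent to \<open>a - b p\<close>, which is nonzero modulo
    \<open>p\<^sup>2\<close>.\<close>
  have "\<exists>!r. r < (\<Prod>p\<in>W. p\<^sup>2) \<and> (\<forall>p\<in>W. [r = p\<^sup>2 * b p - b p] (mod p\<^sup>2))"
    by (rule chinese_remainder_unique_nat) (use finW cop in \<open>auto simp: W_def prime_gt_0_nat\<close>)
  then obtain r where r: "r < M" "\<And>p. p \<in> W \<Longrightarrow> [r = p\<^sup>2 * b p - b p] (mod p\<^sup>2)"
    unfolding M_def by blast
  have small: "\<not> p\<^sup>2 dvd r + M * m + a" if "p \<in> W" "a \<in> A" for p a m
  proof
    assume dvd: "p\<^sup>2 dvd r + M * m + a"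
    have p: "prime p" using that by (simp add: W_def)
    have "p\<^sup>2 dvd M * m" unfolding M_def using that finW by (intro dvd_mult2 dvd_prodI)
    then have "p\<^sup>2 dvd r + a" using dvd by (metis add.assoc add.commute dvd_add_right_iff)
    moreover have "[r + b p = (p\<^sup>2 * b p - b p) + b p] (mod p\<^sup>2)"
      using r(2)[OF that(1)] by (rule cong_add) simp
    moreover have "(p\<^sup>2 * b p - b p) + b p = p\<^sup>2 * b p"
      using prime_gt_0_nat[OF p] by simp
    ultimately have "[r + a = r + b p] (mod p\<^sup>2)"
      by (simp add: Cong.cong_def mod_eq_0_iff_dvd)
    then have "[a = b p] (mod p\<^sup>2)" by (simp only: cong_add_lcancel_nat)
    then show False using b p that by blast
  qed
  define B where "B = (\<lambda>p. {m \<in> {..<p\<^sup>2}. \<exists>a\<in>A. p\<^sup>2 dvd r + M * m + a})"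
  have B: "card (B p) \<le> k" if "prime p" "p > Y" for p
  proof -
    have "coprime M (p\<^sup>2)" unfolding M_def
      using that cop by (intro prod_coprime_left) (auto simp: W_def)
    then show ?thesis unfolding B_def
      using card_dvd_linear_le[OF A(1), of M "p\<^sup>2" r] A(2) that prime_gt_0_nat by fastforce
  qed
  have mem_B: "m mod p\<^sup>2 \<in> B p \<longleftrightarrow> (\<exists>a\<in>A. p\<^sup>2 dvd r + M * m + a)" if "prime p" for m p
  proof -
    have "[r + M * (m mod p\<^sup>2) + a = r + M * m + a] (mod p\<^sup>2)" for a
      by (intro cong_add cong_mult cong_refl) (simp add: Cong.cong_def)
    then have "p\<^sup>2 dvd r + M * (m mod p\<^sup>2) + a \<longleftrightarrow> p\<^sup>2 dvd r + M * m + a" for a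
      by (rule cong_dvd_iff)
    moreover have "m mod p\<^sup>2 < p\<^sup>2" using prime_gt_0_nat[OF that] by simp
    ultimately show ?thesis by (auto simp only: B_def mem_Collect_eq lessThan_iff)
  qed
  \<comment> \<open>The least multiplier with \<open>M * u > x\<close>, so every candidate exceeds
    \<open>x\<close>.\<close>
  define u where "u = x div M + 1"
  define P1 where "P1 = {p. prime p \<and> Y < p \<and> p \<le> Z}"
  define P2 where "P2 = {p. prime p \<and> Z < p \<and> p \<le> T}"
  have fin: "finite P1" "finite P2" by (simp_all add: P1_def P2_def)
  define G where "G = {m \<in> {u..<u + X}. \<forall>p\<in>P1. m mod p\<^sup>2 \<notin> B p}"
  have kY: "2 * k \<le> p\<^sup>2" if "p > Y" for p
    by (rule order_trans[OF Y(2) power_mono]) (use that in auto)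
  have G: "real X * exp (- 2 * S) / 2 - 3 * real (k * Z) ^ R \<le> real (card G)"
    unfolding G_def
  proof (rule brun_sieve)
    show "(\<Sum>p\<in>P1. real (card (B p)) / real (p\<^sup>2)) \<le> S"
    proof -
      have "(\<Sum>p\<in>P1. real (card (B p)) / real (p\<^sup>2)) \<le> (\<Sum>p\<in>P1. real k * (1 / (real p)\<^sup>2))"
        by (rule sum_mono) (use B in \<open>auto simp: P1_def intro!: divide_right_mono\<close>)
      also have "\<dots> \<le> (\<Sum>p\<in>{Y<..Z}. real k * (1 / (real p)\<^sup>2))"
        by (rule sum_mono2) (auto simp: P1_def)
      also have "\<dots> \<le> real k * (1 / real Y)"
        unfolding sum_distrib_left[symmetric]
        by (intro mult_left_mono sum_inverse_squares_le Y) simp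
      finally show ?thesis using Y(3) by simp
    qed
    have "card P1 \<le> card {1..Z}" by (rule card_mono) (auto simp: P1_def)
    then show "card P1 \<le> Z" by simp
    show "2 * card (B p) \<le> p\<^sup>2" if "p \<in> P1" for p
      using B[of p] kY[of p] that by (auto simp: P1_def)
    show "p\<^sup>2 > 0" if "p \<in> P1" for p using that by (auto simp: P1_def prime_gt_0_nat)
    show "coprime (p\<^sup>2) (r\<^sup>2)" if "p \<in> P1" "r \<in> P1" "p \<noteq> r" for p r
      using that cop unfolding P1_def by blast
    show "card (B p) \<le> k" if "p \<in> P1" for p using that B by (auto simp: P1_def)
    show "Z > 0" using Y by simp
  qed (use fin A R in \<open>auto simp: B_def\<close>)
  \<comment> \<open>Union bound: a prime \<open>p\<close> in \<open>P2\<close> destroys at most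
    \<open>k * X / p\<^sup>2 + k\<close> of the \<open>m\<close>. The first terms sum to at most
    \<open>k * X / Z\<close>, the second to at most \<open>k * T\<close>.\<close>
  have "real (card (\<Union>p\<in>P2. {m \<in> {u..<u + X}. m mod p\<^sup>2 \<in> B p}))
      \<le> (\<Sum>p\<in>P2. real (card {m \<in> {u..<u + X}. m mod p\<^sup>2 \<in> B p}))"
    using card_UN_le[OF fin(2)] by (simp flip: of_nat_sum)
  also have "\<dots> \<le> (\<Sum>p\<in>P2. real k * real X * (1 / (real p)\<^sup>2) + real k)"
  proof (rule sum_mono)
    fix p assume p: "p \<in> P2"
    have "card (B p) \<le> k" using p B Y(4) by (auto simp: P2_def)
    moreover have "real X * real (card (B p)) / (real p)\<^sup>2 \<le> real X * real k / (real p)\<^sup>2"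
      using calculation by (intro divide_right_mono mult_left_mono) auto
    moreover have "B p \<subseteq> {..<p\<^sup>2}" by (auto simp: B_def)
    ultimately show "real (card {m \<in> {u..<u + X}. m mod p\<^sup>2 \<in> B p})
        \<le> real k * real X * (1 / (real p)\<^sup>2) + real k"
      using card_interval_residues[of "B p" "p\<^sup>2" u X] by (simp add: mult.commute)
  qed
  also have "\<dots> = (\<Sum>p\<in>P2. real k * real X * (1 / (real p)\<^sup>2)) + real (card P2) * real k"
    by (simp add: sum.distrib)
  also have "\<dots> \<le> real k * real X / real Z + real k * real T"
  proof (rule add_mono)
    have "(\<Sum>p\<in>P2. real k * real X * (1 / (real p)\<^sup>2)) \<le> (\<Sum>p\<in>{Z<..T}. real k * real X * (1 / (real p)\<^sup>2))"
      by (rule sum_mono2) (auto simp: P2_def)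
    also have "\<dots> \<le> real k * real X * (1 / real Z)"
      unfolding sum_distrib_left[symmetric]
      by (intro mult_left_mono sum_inverse_squares_le) (use Y in auto)
    finally show "(\<Sum>p\<in>P2. real k * real X * (1 / (real p)\<^sup>2)) \<le> real k * real X / real Z" by simp
    have "card P2 \<le> card {1..T}" by (rule card_mono) (auto simp: P2_def)
    then show "real (card P2) * real k \<le> real k * real T"
      by (subst mult.commute) (intro mult_left_mono, auto)
  qed
  finally have "card (\<Union>p\<in>P2. {m \<in> {u..<u + X}. m mod p\<^sup>2 \<in> B p}) < card G"
    using main G by simp
  then have "\<not> G \<subseteq> (\<Union>p\<in>P2. {m \<in> {u..<u + X}. m mod p\<^sup>2 \<in> B p})"
    using card_mono[of "\<Union>p\<in>P2. {m \<in> {u..<u + X}. m mod p\<^sup>2 \<in> B p}" G] fin by auto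
  then obtain m where m: "u \<le> m" "m < u + X" "\<And>p. p \<in> P1 \<union> P2 \<Longrightarrow> m mod p\<^sup>2 \<notin> B p"
    by (auto simp: G_def)
  have "x < M * u" unfolding u_def using r(1)
    by (metis Suc_eq_plus1 dividend_less_times_div mult.commute mult_Suc_right not_gr_zero not_less_zero add.commute)
  also have "\<dots> \<le> M * m" using m(1) by simp
  finally have lower: "x < r + M * m" by simp
  have "M * Suc m \<le> M * (u + X)" using m(2) by (intro mult_left_mono) auto
  then have "M * m \<le> M * (x div M) + M * X" by (simp add: u_def algebra_simps)
  moreover have "M * (x div M) \<le> x" by (rule times_div_less_eq_dividend)
  moreover have "M * X + M \<le> H" using H by (simp add: M_def W_def)
  ultimately have upper: "r + M * m < x + H" using r(1) by linarith
  have "squarefree (r + M * m + a)" if a: "a \<in> A" for a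
  proof (subst squarefree_factorial_semiring)
    show "r + M * m + a \<noteq> 0" using lower by linarith
    show "\<forall>p. prime p \<longrightarrow> \<not> p\<^sup>2 dvd r + M * m + a"
    proof (intro allI impI notI)
      \<comment> \<open>Such a prime is at most \<open>T\<close>, hence lies in \<open>W\<close>,
        \<open>P1\<close> or \<open>P2\<close>. The choice of \<open>r\<close> rules out the first,
        the choice of \<open>m\<close> the other two.\<close>
      fix p :: nat assume p: "prime p" "p\<^sup>2 dvd r + M * m + a"
      have "p\<^sup>2 \<le> r + M * m + a" using p(2) lower by (intro dvd_imp_le) linarith+
      also have "\<dots> \<le> T\<^sup>2" using upper T A(4) a by auto
      finally have "p \<le> T" by (simp add: power2_nat_le_eq_le)
      moreover have "m mod p\<^sup>2 \<in> B p" using mem_B p a by blast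
      moreover have "p \<notin> W" using small a p by blast
      ultimately show False using m(3)[of p] p by (cases "p \<le> Z") (auto simp: P1_def P2_def W_def)
    qed
  qed
  with lower upper show ?thesis by blast
qed

section \<open>Choice of parameters and asymptotics\<close>

text \<open>With \<open>s\<close> the cube root of \<open>j\<close>, the logarithms of
  \<open>Y ^ (2 * Y)\<close> and \<open>(j * Z) ^ R\<close> are \<open>O (s\<^sup>2 ln j)\<close>
  and \<open>O (s\<^sup>2)\<close>. The exponent 3/4 exceeds 2/3, which absorbs logarithm and
  constants, and is below 1, which keeps it within the growth of the sequence.\<close>

lemma sieve_parameters:
  "\<forall>\<^sub>F j :: nat in sequentially. j \<ge> 1 \<and>
     (\<exists>Y Z R. Y > 0 \<and> 2 * j \<le> Y\<^sup>2 \<and> real j / real Y \<le> real j powr (1 / 3) \<and> Y \<le> Z \<and>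
       8 * real j * exp (2 * real j powr (1 / 3)) \<le> real Z \<and>
       odd R \<and> 2 * exp (4 * real j powr (1 / 3)) \<le> 2 ^ R \<and>
       real (Y ^ (2 * Y)) \<le> exp (real j powr (3 / 4)) \<and>
       real (j * Z) ^ R \<le> exp (real j powr (3 / 4)))"
proof -
  have "\<forall>\<^sub>F j :: nat in sequentially. 2 * real j \<le> (real j powr (2 / 3))\<^sup>2" by real_asymp
  moreover have "\<forall>\<^sub>F j :: nat in sequentially.
      2 * (real j powr (2 / 3) + 1) * ln (real j powr (2 / 3) + 1) \<le> real j powr (3 / 4)" by real_asymp
  moreover have "\<forall>\<^sub>F j :: nat in sequentially. real j powr (2 / 3) + 1 \<le> 8 * real j" by real_asymp
  moreover have "\<forall>\<^sub>F j :: nat in sequentially.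
      (8 * real j powr (1 / 3) + 5) * (ln 9 + 2 * ln (real j) + 2 * real j powr (1 / 3)) \<le> real j powr (3 / 4)"
    by real_asymp
  ultimately show ?thesis using eventually_ge_at_top[of 1]
  proof eventually_elim
    case (elim j)
    define s where "s = real j powr (1 / 3)"
    define t where "t = real j powr (2 / 3)"
    define Y where "Y = nat \<lceil>t\<rceil>"
    define Z where "Z = nat \<lceil>8 * real j * exp (2 * s)\<rceil>"
    \<comment> \<open>Odd, and at least \<open>8 * s + 3\<close>: as \<open>ln 2\<close> \<ge> 1/2,
      \<open>2 ^ R\<close> is at least \<open>exp (4 * s + 3 / 2)\<close>, and
      \<open>exp (3 / 2)\<close> exceeds 2.\<close>
    define R where "R = 2 * nat \<lceil>4 * s\<rceil> + 3"
    have j: "real j \<ge> 1" using elim by simp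
    have st: "s \<ge> 0" "t \<ge> 1" "s * t = real j"
      using j by (auto simp: s_def t_def ge_one_powr_ge_zero simp flip: powr_add)
    have Y: "t \<le> real Y" "real Y \<le> t + 1" unfolding Y_def using st by linarith+
    have "t\<^sup>2 \<le> (real Y)\<^sup>2" using st Y by (intro power_mono) auto
    then have "2 * real j \<le> (real Y)\<^sup>2" using elim(1) unfolding t_def by linarith
    then have "real (2 * j) \<le> real (Y\<^sup>2)" by simp
    then have 1: "2 * j \<le> Y\<^sup>2" by (simp only: of_nat_le_iff)
    have 2: "real j / real Y \<le> s"
      using Y st by (simp add: divide_le_eq mult_left_mono flip: st(3))
    have Z: "8 * real j * exp (2 * s) \<le> real Z" "real Z \<le> 8 * real j * exp (2 * s) + 1"
    proof -
      have "0 \<le> 8 * real j * exp (2 * s)" by simp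
      then show "8 * real j * exp (2 * s) \<le> real Z" "real Z \<le> 8 * real j * exp (2 * s) + 1"
        unfolding Z_def by linarith+
    qed
    have "8 * real j * 1 \<le> 8 * real j * exp (2 * s)" using st by (intro mult_left_mono) auto
    then have "real Y \<le> real Z" using Y Z elim(3) by (simp add: t_def)
    then have 3: "Y \<le> Z" by simp
    have R: "8 * s + 3 \<le> real R" "real R \<le> 8 * s + 5" unfolding R_def using st by linarith+
    have "exp 1 \<le> (2::real) ^ 2" using exp_le by simp
    then have "(1::real) \<le> ln (2 ^ 2)" by (subst ln_ge_iff) auto
    then have ln2: "1 / 2 \<le> ln (2::real)" by (subst (asm) ln_realpow) auto
    have "(2::real) * exp (4 * s) \<le> exp (3 / 2) * exp (4 * s)"
      using exp_ge_add_one_self[of "3 / 2"] by (intro mult_right_mono) auto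
    also have "\<dots> = exp ((8 * s + 3) * (1 / 2))" by (simp add: algebra_simps flip: exp_add)
    also have "\<dots> \<le> exp (real R * ln 2)"
      unfolding exp_le_cancel_iff using R(1) ln2 st by (intro mult_mono) auto
    also have "\<dots> = 2 ^ R" by (simp add: exp_of_nat_mult)
    finally have 4: "2 * exp (4 * s) \<le> 2 ^ R" .
    have Ypos: "real Y \<ge> 1" using Y st by simp
    have "real (Y ^ (2 * Y)) = exp (real (2 * Y) * ln (real Y))"
      using Ypos by (simp only: exp_of_nat_mult exp_ln of_nat_power)
    also have "\<dots> \<le> exp (2 * (t + 1) * ln (t + 1))"
      using Y Ypos st by (auto intro!: mult_mono)
    also have "\<dots> \<le> exp (real j powr (3 / 4))" using elim(2) by (simp add: t_def)
    finally have 5: "real (Y ^ (2 * Y)) \<le> exp (real j powr (3 / 4))" .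
    have "1 * 1 \<le> real j * exp (2 * s)" using j st by (intro mult_mono) auto
    then have "real (j * Z) \<le> real j * (9 * real j * exp (2 * s))"
      using Z(2) by (simp add: mult_left_mono)
    also have "\<dots> = exp (ln 9 + 2 * ln (real j) + 2 * s)"
      using j by (simp add: exp_add exp_double power2_eq_square)
    finally have "real (j * Z) ^ R \<le> exp (ln 9 + 2 * ln (real j) + 2 * s) ^ R"
      by (rule power_mono) simp
    also have "\<dots> = exp (real R * (ln 9 + 2 * ln (real j) + 2 * s))"
      by (rule exp_of_nat_mult[symmetric])
    also have "\<dots> \<le> exp ((8 * s + 5) * (ln 9 + 2 * ln (real j) + 2 * s))"
      using R(2) j st by (auto intro!: mult_right_mono add_nonneg_nonneg)
    also have "\<dots> \<le> exp (real j powr (3 / 4))" using elim(4) by (simp add: s_def)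
    finally have 6: "real (j * Z) ^ R \<le> exp (real j powr (3 / 4))" .
    show ?case
      unfolding s_def[symmetric] using elim(5) Ypos 1 2 3 4 5 6 Z(1)
      by (intro conjI exI[of _ Y] exI[of _ Z] exI[of _ R]) (auto simp: R_def)
  qed
qed

text \<open>The left side majorises the sieve error and the cost \<open>j * T\<close> of large
  primes; the right side minorises 3/8 of \<open>X * exp (- 2 * s)\<close>. The leading exponents
  are 1/2 + 1/100 and 10/11 - 2/100.\<close>

lemma gap_exponent_inequality:
  "\<forall>\<^sub>F x :: real in at_top.
     3 * x powr (1/100) + x powr (1/100) * (2 * sqrt x + 1)
       < ((x powr (10/11) - 1) * x powr (- 1/100) - 2) * x powr (- 1/100) * (3/8)"
  by real_asymp

text \<open>Uniform in \<open>A\<close> and \<open>x\<close>, since both vary with \<open>j\<close>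
  in the application. The lower bound on \<open>x\<close> turns every factor
  \<open>exp (j powr (3 / 4))\<close> into at most \<open>x powr (1 / 100)\<close>.\<close>

lemma gap_contains_squarefree_shift:
  "\<forall>\<^sub>F j :: nat in sequentially. \<forall>(A :: nat set) x.
     finite A \<longrightarrow> card A \<le> j \<longrightarrow> A \<subseteq> {..x} \<longrightarrow> admissible A \<longrightarrow>
     exp (100 * real j powr (3 / 4)) \<le> real x \<longrightarrow>
     (\<exists>n. x < n \<and> real n < real x + real x powr (10 / 11) \<and> (\<forall>a\<in>A. squarefree (n + a)))"
proof -
  obtain x0 where x0: "\<And>x::real. x \<ge> x0 \<Longrightarrow> 3 * x powr (1/100) + x powr (1/100) * (2 * sqrt x + 1)
       < ((x powr (10/11) - 1) * x powr (- 1/100) - 2) * x powr (- 1/100) * (3/8)"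
    using gap_exponent_inequality unfolding eventually_at_top_linorder by blast
  have "\<forall>\<^sub>F j :: nat in sequentially. x0 \<le> exp (100 * real j powr (3 / 4))"
  proof -
    have "filterlim (\<lambda>j::nat. exp (100 * real j powr (3 / 4))) at_top sequentially" by real_asymp
    then show ?thesis by (simp add: filterlim_at_top)
  qed
  moreover have "\<forall>\<^sub>F j :: nat in sequentially. real j \<le> exp (real j powr (3 / 4))" by real_asymp
  moreover have "\<forall>\<^sub>F j :: nat in sequentially. 2 * real j powr (1 / 3) \<le> real j powr (3 / 4)" by real_asymp
  ultimately show ?thesis using sieve_parameters
  proof eventually_elim
    case (elim j)
    show ?case
    proof (intro allI impI)
      fix A :: "nat set" and x :: nat
      assume A: "finite A" "card A \<le> j" "A \<subseteq> {..x}" "admissible A"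
      assume x: "exp (100 * real j powr (3 / 4)) \<le> real x"
      define s where "s = real j powr (1 / 3)"
      \<comment> \<open>\<open>e\<close> will majorise \<open>M\<close>, \<open>j\<close>,
        \<open>exp (2 * s)\<close> and \<open>(j * Z) ^ R\<close>; its inverse \<open>f\<close> then
        minorises \<open>1 / M\<close> and \<open>exp (- 2 * s)\<close>.\<close>
      define e where "e = real x powr (1 / 100)"
      define f where "f = real x powr (- 1 / 100)"
      obtain Y Z R where j: "j \<ge> 1" and Y: "Y > 0" "2 * j \<le> Y\<^sup>2" "real j / real Y \<le> s" "Y \<le> Z"
        and Z: "8 * real j * exp (2 * s) \<le> real Z"
        and R: "odd R" "2 * exp (4 * s) \<le> 2 ^ R"
        and small: "real (Y ^ (2 * Y)) \<le> exp (real j powr (3 / 4))"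
          "real (j * Z) ^ R \<le> exp (real j powr (3 / 4))"
        using elim(4) unfolding s_def by blast
      have x1: "real x \<ge> 1" by (rule order_trans[OF _ x]) simp
      have ef: "e > 0" "f > 0" "e * f = 1"
        using x1 by (auto simp: e_def f_def simp flip: powr_add)
      have e: "exp (real j powr (3 / 4)) \<le> e"
      proof -
        have "100 * real j powr (3 / 4) \<le> ln (real x)"
          using x x1 by (simp add: ln_ge_iff)
        then show ?thesis using x1 by (simp add: e_def powr_def)
      qed
      define M where "M = (\<Prod>p | prime p \<and> p \<le> Y. p\<^sup>2)"
      define H where "H = nat \<lfloor>real x powr (10 / 11)\<rfloor>"
      \<comment> \<open>One period is set aside for the offset \<open>r < M\<close>, so that
        \<open>M * (X + 1)\<close> fits into \<open>H\<close>.\<close>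
      define X where "X = H div M - 1"
      \<comment> \<open>Then \<open>T\<^sup>2\<close> \<ge> \<open>4 * x\<close>, which covers
        \<open>2 * x + H\<close> because \<open>H\<close> \<le> \<open>x\<close>.\<close>
      define T where "T = nat \<lceil>2 * sqrt (real x)\<rceil>"
      have H: "real x powr (10 / 11) - 1 \<le> real H" "real H \<le> real x powr (10 / 11)"
        unfolding H_def by (smt (verit) powr_ge_zero of_nat_nat zero_le_floor real_of_int_floor_gt_diff_one of_int_floor_le)+
      have "M \<le> Y ^ (2 * Y)" unfolding M_def by (rule prod_prime_squares_le) (rule Y)
      then have "real M \<le> real (Y ^ (2 * Y))" by (simp only: of_nat_le_iff)
      then have M: "real M \<le> e" using small(1) e by linarith
      have "M > 0" unfolding M_def by (rule prod_pos) (auto simp: prime_gt_0_nat)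
      have "f \<le> 1 / real M"
        using M ef \<open>M > 0\<close> by (simp add: pos_le_divide_eq) (metis mult.commute mult_left_mono order_less_imp_le)
      then have "(real x powr (10 / 11) - 1) * f \<le> real H * (1 / real M)"
        using H(1) x1 ef by (intro mult_mono) (auto simp: ge_one_powr_ge_zero)
      also have "\<dots> \<le> real X + 2"
      proof -
        have "H < M * (H div M + 1)" using \<open>M > 0\<close> by (simp add: dividend_less_times_div)
        then have "real H < real (M * (H div M + 1))" by (simp only: of_nat_less_iff)
        then have "real H / real M < real (H div M) + 1"
          using \<open>M > 0\<close> by (simp add: pos_divide_less_eq algebra_simps)
        then show ?thesis by (simp add: X_def)
      qed
      finally have X: "(real x powr (10 / 11) - 1) * f - 2 \<le> real X" by simp
      \<comment> \<open>The factor 3/8 is the 1/2 of the sieve bound less the 1/8 lost to the term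
        \<open>j * X / Z\<close>.\<close>
      have main: "3 * e + e * (2 * sqrt (real x) + 1) < ((real x powr (10 / 11) - 1) * f - 2) * f * (3 / 8)"
        unfolding e_def f_def using elim(1) x by (intro x0) simp
      also have "\<dots> \<le> real X * f * (3 / 8)"
        using X ef by (intro mult_right_mono) auto
      finally have main: "3 * e + e * (2 * sqrt (real x) + 1) < real X * f * (3 / 8)" .
      have T: "2 * sqrt (real x) \<le> real T" "real T \<le> 2 * sqrt (real x) + 1"
        unfolding T_def using real_sqrt_ge_zero[of "real x"] by linarith+
      have "\<exists>n. x < n \<and> n < x + H \<and> (\<forall>a\<in>A. squarefree (n + a))"
      proof (rule exists_squarefree_shift[where k = j and Y = Y and Z = Z and R = R and T = T and X = X and S = s])
        \<comment> \<open>Positivity of \<open>X\<close> shows that the subtraction in its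
          definition was not truncated.\<close>
        have "0 \<le> 3 * e + e * (2 * sqrt (real x) + 1)" using ef by simp
        then have "real X > 0" using main ef by (metis less_eq_real_def mult_zero_left not_less of_nat_0_less_iff gr0I of_nat_0)
        then have "X + 1 = H div M" by (simp add: X_def)
        then show "(\<Prod>p | prime p \<and> p \<le> Y. p\<^sup>2) * (X + 1) \<le> H" by (simp add: M_def[symmetric])
        have "real x powr (10 / 11) \<le> real x powr 1" using x1 by (intro powr_mono) auto
        then have "real H \<le> real x" using H x1 by simp
        moreover have "(2 * sqrt (real x))\<^sup>2 \<le> (real T)\<^sup>2" using T(1) by (intro power_mono) auto
        ultimately have "real (2 * x + H) \<le> real (T\<^sup>2)" by (simp add: power_mult_distrib)
        then show "2 * x + H \<le> T\<^sup>2" by (simp only: of_nat_le_iff)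
        have "f * exp (2 * s) \<le> f * e"
          using e elim(3) ef(2) by (intro mult_left_mono) (auto simp: s_def intro: order_trans)
        then have fs: "f \<le> exp (- 2 * s)"
          using ef by (simp add: exp_minus field_simps)
        have "real j * real X / real Z \<le> real j * real X / (8 * real j * exp (2 * s))"
          using Z j Y(1,4) by (intro divide_left_mono) (auto intro!: mult_pos_pos)
        also have "\<dots> = real X * exp (- 2 * s) / 8" using j by (simp add: exp_minus field_simps)
        finally have 1: "real j * real X / real Z \<le> real X * exp (- 2 * s) / 8" .
        have 2: "real j * real T \<le> e * (2 * sqrt (real x) + 1)"
          using elim(2) e T ef by (intro mult_mono) auto
        have 3: "real X * f * (3 / 8) \<le> real X * exp (- 2 * s) * (3 / 8)"
          using fs by (intro mult_right_mono mult_left_mono) auto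
        show "real j * real X / real Z + real j * real T
            < real X * exp (- 2 * s) / 2 - 3 * real (j * Z) ^ R"
          using 1 2 3 main small(2) e by linarith
      qed (use A j Y R in auto)
      then obtain n where n: "x < n" "n < x + H" "\<forall>a\<in>A. squarefree (n + a)" by blast
      have "real n < real (x + H)" using n(2) by (simp only: of_nat_less_iff)
      then show "\<exists>n. x < n \<and> real n < real x + real x powr (10 / 11) \<and> (\<forall>a\<in>A. squarefree (n + a))"
        using n H(2) by (intro exI[of _ n]) auto
    qed
  qed
qed

section \<open>Gaps of the given sequence\<close>

theorem theorem1p6:
  fixes A :: "nat set" and a :: "nat \<Rightarrow> nat"
  assumes "A = a ` {1..}"
    and "strict_mono_on {1..} a"
    and "admissible A"
    and "\<forall>\<^sub>F j in sequentially.
           real (a j) \<ge> max (exp (5 * real j / ln (real j)))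
                              (real (a (j - 1)) + real (a (j - 1)) powr (10 / 11))"
  shows "\<forall>\<^sub>F j in sequentially.
           \<exists>n::nat. a (j - 1) < n \<and> n < a j \<and> (\<forall>i\<in>{1..<j}. squarefree (n + a i))"
proof -
  \<comment> \<open>The gap begins at \<open>a (j - 1)\<close>, so the exponential growth is needed
    at index \<open>j - 1\<close>, while the gap condition is used at \<open>j\<close>.\<close>
  have "filterlim (\<lambda>j::nat. j - 1) sequentially sequentially" by (rule filterlim_minus_const_nat_at_top)
  then have "\<forall>\<^sub>F j in sequentially. real (a (j - 1)) \<ge> max (exp (5 * real (j - 1) / ln (real (j - 1))))
                              (real (a (j - 1 - 1)) + real (a (j - 1 - 1)) powr (10 / 11))"
    using assms(4) by (rule eventually_compose_filterlim[rotated])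
  moreover have "\<forall>\<^sub>F j :: nat in sequentially.
      100 * real j powr (3/4) \<le> 5 * real (j - 1) / ln (real (j - 1))"
    by real_asymp
  ultimately show ?thesis using assms(4) gap_contains_squarefree_shift eventually_ge_at_top[of 2]
  proof eventually_elim
    case (elim j)
    have "finite (a ` {1..<j})" by simp
    moreover have "card (a ` {1..<j}) \<le> j"
      using card_image_le[of "{1..<j}" a] by simp
    moreover have "a i \<le> a (j - 1)" if "i \<in> {1..<j}" for i
      using strict_mono_on_leD[OF assms(2), of i "j - 1"] that by auto
    then have "a ` {1..<j} \<subseteq> {..a (j - 1)}" by auto
    moreover have "admissible (a ` {1..<j})"
      using assms(1,3) unfolding admissible_def by (metis (no_types, lifting) atLeastLessThan_iff atLeast_iff imageE imageI)
    moreover have "exp (100 * real j powr (3 / 4)) \<le> real (a (j - 1))"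
      using elim(1) elim(2) by (meson exp_le_cancel_iff max.boundedE order_trans)
    ultimately obtain n where n: "a (j - 1) < n" "real n < real (a (j - 1)) + real (a (j - 1)) powr (10 / 11)"
      "\<forall>b\<in>a ` {1..<j}. squarefree (n + b)"
      using elim(4) by blast
    have "real n < real (a j)" using n(2) elim(3) by simp
    then show ?case using n by auto
  qed
qed

end
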